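(* Let $n$ be a positive integer and let $\mathcal{A}_3$ be the antichain of size $3$. (i) If $\mathcal{P}$ is a non-empty finite poset that does not have a unique maximal element, then $\mathrm{sat}^*(n,\mathcal{A}_3*\mathcal{P})\geq \mathrm{sat}^*(n,\mathcal{V}_3)\geq \frac{n}{2}$. (ii) If $\mathcal{P}$ is a non-empty finite poset that does not have a unique minimal element, then $\mathrm{sat}^*(n,\mathcal{P}*\mathcal{A}_3)\geq \mathrm{sat}^*(n,\Lambda_3)\geq \frac{n}{2}$.
   Context: Let $[n]=\{1,\dots,n\}$ and let $\mathcal{P}([n])$ be the power set of $[n]$ ordered by inclusion. A family $\mathcal{F}\subseteq\mathcal{P}([n])$ is regarded as a poset under inclusion. A poset $(\mathcal{Q},\leq')$ contains an induced copy of a poset $(\mathcal{P},\leq)$ if there is an injective function $f:\mathcal{P}\to\mathcal{Q}$ such that for all $u,v\in\mathcal{P}$, $u\leq v$ if and only if $f(u)\leq' f(v)$; otherwise $\mathcal{Q}$ is $\mathcal{P}$-free. A family $\mathcal{F}\subseteq\mathcal{P}([n])$ is $\mathcal{P}$-saturated if $\mathcal{F}$ is $\mathcal{P}$-free but $\mathcal{F}\cup\{S\}$ contains an induced copy of $\mathcal{P}$ for every $S\in\mathcal{P}([n])\setminus\mathcal{F}$. The induced saturation number $\mathrm{sat}^*(n,\mathcal{P})$ is the minimum size of a $\mathcal{P}$-saturated family in $\mathcal{P}([n])$. For finite posets $\mathcal{P}$ and $\mathcal{Q}$, $\mathcal{P}*\mathcal{Q}$ (the linear sum) is the poset obtained by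 putting a copy of $\mathcal{P}$ entirely on top of a copy of $\mathcal{Q}$: its underlying set is the disjoint union of $\mathcal{P}$ and $\mathcal{Q}$, the orders within $\mathcal{P}$ and within $\mathcal{Q}$ are kept, and every element of $\mathcal{P}$ is greater than every element of $\mathcal{Q}$. $\mathcal{V}_3$ is the four-element poset with one minimum element lying below three pairwise incomparable maximal elements; $\Lambda_3$ is the four-element poset with one maximum element lying above three pairwise incomparable minimal elements. *)

theory Defs
  imports Complex_Main
begin

text \<open>
  A poset is a relation \<open>r\<close> with \<open>Partial_order r\<close>: its elements are those of \<open>Field r\<close>, and
  \<open>(x, y) \<in> r\<close> means that \<open>x\<close> is below or equal to \<open>y\<close>.
\<close>

definition contains_induced_copy :: "'b rel \<Rightarrow> 'a rel \<Rightarrow> bool" where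
  "contains_induced_copy s r \<longleftrightarrow>
     (\<exists>f. inj_on f (Field r) \<and> f ` Field r \<subseteq> Field s \<and>
          (\<forall>u\<in>Field r. \<forall>v\<in>Field r. (u, v) \<in> r \<longleftrightarrow> (f u, f v) \<in> s))"

definition poset_free :: "'a rel \<Rightarrow> 'b rel \<Rightarrow> bool" where
  "poset_free r s \<longleftrightarrow> \<not> contains_induced_copy s r"

definition inclusion_poset :: "'a set set \<Rightarrow> 'a set rel" where
  "inclusion_poset F = relation_of (\<subseteq>) F"

definition poset_saturated :: "nat \<Rightarrow> 'a rel \<Rightarrow> nat set set \<Rightarrow> bool" where
  "poset_saturated n r F \<longleftrightarrow>
     F \<subseteq> Pow {1..n} \<and>
     poset_free r (inclusion_poset F) \<and>
     (\<forall>S\<in>Pow {1..n} - F. contains_induced_copy (inclusion_poset (F \<union> {S})) r)"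

text \<open>
  The set below is finite and, by \<open>poset_saturated_exists\<close>, nonempty whenever \<open>r\<close> is nonempty.
\<close>

definition sat_star :: "nat \<Rightarrow> 'a rel \<Rightarrow> nat" where
  "sat_star n r = Min (card ` {F. poset_saturated n r F})"

text \<open>The first argument is placed on top of the second.\<close>

definition linear_sum :: "'a rel \<Rightarrow> 'b rel \<Rightarrow> ('a + 'b) rel" where
  "linear_sum p q =
     {(Inl x, Inl y) | x y. (x, y) \<in> p} \<union>
     {(Inr x, Inr y) | x y. (x, y) \<in> q} \<union>
     {(Inr x, Inl y) | x y. x \<in> Field q \<and> y \<in> Field p}"

definition maximal_element :: "'a rel \<Rightarrow> 'a \<Rightarrow> bool" where
  "maximal_element r x \<longleftrightarrow> x \<in> Field r \<and> (\<forall>y\<in>Field r. (x, y) \<in> r \<longrightarrow> y = x)"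

definition minimal_element :: "'a rel \<Rightarrow> 'a \<Rightarrow> bool" where
  "minimal_element r x \<longleftrightarrow> x \<in> Field r \<and> (\<forall>y\<in>Field r. (y, x) \<in> r \<longrightarrow> y = x)"

definition antichain3 :: "nat rel" where
  "antichain3 = Id_on {1, 2, 3}"

definition V3 :: "nat rel" where
  "V3 = Id_on {0, 1, 2, 3} \<union> {(0, 1), (0, 2), (0, 3)}"

definition Lambda3 :: "nat rel" where
  "Lambda3 = Id_on {0, 1, 2, 3} \<union> {(1, 0), (2, 0), (3, 0)}"

lemma Field_inclusion_poset: "Field (inclusion_poset F) = F"
  by (auto simp: inclusion_poset_def relation_of_def Field_def)

lemma Field_linear_sum: "Field (linear_sum p q) = Field p <+> Field q"
proof (rule set_eqI)
  fix z
  show "z \<in> Field (linear_sum p q) \<longleftrightarrow> z \<in> Field p <+> Field q"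
    by (cases z) (auto simp: linear_sum_def Field_iff)
qed

lemma Partial_order_inclusion_poset: "Partial_order (inclusion_poset F)"
  unfolding Field_inclusion_poset
  unfolding inclusion_poset_def by (rule partial_order_on_relation_ofI) auto

lemma Partial_order_linear_sum:
  assumes "Partial_order p" "Partial_order q"
  shows "Partial_order (linear_sum p q)"
proof -
  let ?s = "linear_sum p q"
  have p: "refl_on (Field p) p" "trans p" "antisym p"
    and q: "refl_on (Field q) q" "trans q" "antisym q"
    using assms by (auto simp: partial_order_on_def preorder_on_def)
  have iff: "(Inl x, Inl y) \<in> ?s \<longleftrightarrow> (x, y) \<in> p" "(Inr u, Inr v) \<in> ?s \<longleftrightarrow> (u, v) \<in> q"
    "(Inr u, Inl y) \<in> ?s \<longleftrightarrow> u \<in> Field q \<and> y \<in> Field p" "(Inl x, Inr v) \<notin> ?s" for x y u v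
    by (auto simp: linear_sum_def)
  have "?s \<subseteq> Field ?s \<times> Field ?s"
    by (auto intro: FieldI1 FieldI2)
  moreover have "refl_on (Field ?s) ?s"
    using p(1) q(1) by (auto simp: Field_linear_sum refl_on_def iff)
  moreover have "trans ?s"
  proof (rule transI)
    fix x y z assume "(x, y) \<in> ?s" "(y, z) \<in> ?s"
    then show "(x, z) \<in> ?s"
      using p(2) q(2)
      by (cases x; cases y; cases z) (auto simp: iff intro: FieldI1 FieldI2 dest: transD)
  qed
  moreover have "antisym ?s"
  proof (rule antisymI)
    fix x y assume "(x, y) \<in> ?s" "(y, x) \<in> ?s"
    then show "x = y"
      using p(3) q(3) by (cases x; cases y) (auto simp: iff dest: antisymD)
  qed
  ultimately show ?thesis
    by (simp add: partial_order_on_def preorder_on_def)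
qed

lemma finite_poset_saturated: "finite {F. poset_saturated n r F}"
  by (rule finite_subset[of _ "Pow (Pow {1..n})"]) (auto simp: poset_saturated_def)

lemma poset_saturated_exists:
  assumes "r \<noteq> {}"
  shows "\<exists>F. poset_saturated n r F"
proof -
  have Field_r: "Field r \<noteq> {}"
    using assms by (auto simp: Field_def)
  let ?C = "{F. F \<subseteq> Pow {1..n} \<and> poset_free r (inclusion_poset F)}"
  have fin: "finite ?C"
    by (rule finite_subset[of _ "Pow (Pow {1..n})"]) auto
  have "{} \<in> ?C"
    using Field_r by (simp add: poset_free_def contains_induced_copy_def Field_inclusion_poset)
  then have ne: "?C \<noteq> {}"
    by (metis empty_iff)
  obtain M where M: "M \<in> ?C" "\<forall>F\<in>?C. M \<subseteq> F \<longrightarrow> M = F"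
    using finite_has_maximal[OF fin ne] by (elim bexE) rule
  have "contains_induced_copy (inclusion_poset (M \<union> {S})) r" if S: "S \<in> Pow {1..n} - M" for S
  proof (rule ccontr)
    assume "\<not> ?thesis"
    then have "M \<union> {S} \<in> ?C"
      using M(1) S by (simp add: poset_free_def)
    with M(2) have "M \<subseteq> M \<union> {S} \<longrightarrow> M = M \<union> {S}"
      by (rule bspec)
    then show False
      using S by auto
  qed
  with M(1) show ?thesis
    by (intro exI[of _ M]) (simp add: poset_saturated_def)
qed

end

theory Submission
  imports Defs
begin

text \<open>
  Say that a family \<open>F\<close> has a triple above a set \<open>X\<close> if three pairwise incomparable members of
  \<open>F\<close> contain \<open>X\<close>. A copy of \<open>V\<^sub>3\<close> in \<open>F\<close> is a member with a triple above it, and a copy of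
  \<open>A\<^sub>3 * P\<close> is a copy of \<open>P\<close> with a triple above the union of its members.

  \<^emph>\<open>Comparison of \<open>A\<^sub>3 * P\<close> with \<open>V\<^sub>3\<close>.\<close> Let \<open>F\<close> be saturated for \<open>A\<^sub>3 * P\<close>, and remove from
  \<open>F\<close> all members that have a triple of \<open>F\<close> above them. What is left, \<open>G\<close>, is no larger than \<open>F\<close>
  and free of \<open>V\<^sub>3\<close>; in fact it is saturated for \<open>V\<^sub>3\<close>
  (\<open>V3_saturated_of_antichain3_sum_saturated\<close>). A set \<open>S\<close> with a triple above it even has one in
  \<open>G\<close>, found by going up as far as possible. Any other \<open>S\<close> outside \<open>F\<close> can only join the top part
  of a copy of \<open>A\<^sub>3 * P\<close>, so it lies with two members of \<open>F\<close> above a copy of \<open>P\<close> in \<open>F\<close>. The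
  union of that copy may be replaced by a minimal union of this kind, and minimality forces such a
  union to belong to \<open>G\<close>, where it is the bottom of a copy of \<open>V\<^sub>3\<close>.

  \<^emph>\<open>The linear bound.\<close> Let \<open>F\<close> be saturated for \<open>V\<^sub>3\<close> and fix a minimal member \<open>M\<close>.
  Each \<open>i\<close> in \<open>{1..n}\<close> is assigned a member of \<open>F\<close> (\<open>V3_saturated_card_ge\<close>). If \<open>i\<close> lies in \<open>M\<close>,
  it is a maximal member among those that miss exactly \<open>i\<close> from \<open>M\<close>. If \<open>i\<close> lies outside \<open>M\<close>, it is some
  \<open>L\<^sub>i\<close> with \<open>i \<in> L\<^sub>i \<subseteq> X\<^sub>i \<union> {i}\<close>, where \<open>X\<^sub>i\<close> is a maximal member with \<open>M \<subseteq> X\<^sub>i\<close> and \<open>i \<notin> X\<^sub>i\<close>. The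
  two kinds of members never coincide, the first kind is assigned only once, and a member
  of the second kind is assigned at most twice: if \<open>L\<^sub>i = L\<^sub>j = L\<^sub>k\<close>, then \<open>X\<^sub>i, X\<^sub>j, X\<^sub>k\<close> are
  incomparable, which is a triple above \<open>M\<close>. Hence \<open>n \<le> 2 |F|\<close>.

  \<^emph>\<open>Duality.\<close> Taking complements reverses inclusion, so a poset and its dual have the same
  saturation number (\<open>sat_star_dual\<close>); this turns the statement for \<open>V\<^sub>3\<close> into the one
  for \<open>\<Lambda>\<^sub>3\<close>.
\<close>

section \<open>Copies described by three incomparable sets\<close>

definition incomparable3 :: "'a set \<Rightarrow> 'a set \<Rightarrow> 'a set \<Rightarrow> bool" where
  "incomparable3 A B C \<longleftrightarrow>
     \<not> A \<subseteq> B \<and> \<not> B \<subseteq> A \<and> \<not> A \<subseteq> C \<and> \<not> C \<subseteq> A \<and> \<not> B \<subseteq> C \<and> \<not> C \<subseteq> B"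

text \<open>
  The inclusions are automatically proper: a set contained in three incomparable sets
  equals none of them.
\<close>

definition triple_above :: "'a set set \<Rightarrow> 'a set \<Rightarrow> bool" where
  "triple_above F X \<longleftrightarrow>
     (\<exists>A\<in>F. \<exists>B\<in>F. \<exists>C\<in>F. incomparable3 A B C \<and> X \<subseteq> A \<and> X \<subseteq> B \<and> X \<subseteq> C)"

definition embeds :: "'b rel \<Rightarrow> 'a set set \<Rightarrow> ('b \<Rightarrow> 'a set) \<Rightarrow> bool" where
  "embeds P F f \<longleftrightarrow> inj_on f (Field P) \<and> f ` Field P \<subseteq> F \<and>
     (\<forall>u\<in>Field P. \<forall>v\<in>Field P. (u, v) \<in> P \<longleftrightarrow> f u \<subseteq> f v)"

lemma triple_aboveI:
  "\<lbrakk>A \<in> F; B \<in> F; C \<in> F; incomparable3 A B C; X \<subseteq> A; X \<subseteq> B; X \<subseteq> C\<rbrakk> \<Longrightarrow> triple_above F X"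
  unfolding triple_above_def by blast

lemma triple_aboveE:
  assumes "triple_above F X"
  obtains A B C where "A \<in> F" "B \<in> F" "C \<in> F" "incomparable3 A B C" "X \<subseteq> A" "X \<subseteq> B" "X \<subseteq> C"
  using assms unfolding triple_above_def by blast

lemma triple_above_antimono: "triple_above F Y \<Longrightarrow> X \<subseteq> Y \<Longrightarrow> triple_above F X"
  unfolding triple_above_def by (meson subset_trans)

lemma triple_above_mono: "triple_above F X \<Longrightarrow> F \<subseteq> G \<Longrightarrow> triple_above G X"
  unfolding triple_above_def by blast

text \<open>
  A triple that uses the new set \<open>S\<close> uses it once, and by symmetry in the first place.
\<close>

lemma triple_above_insert:
  assumes "triple_above (insert S F) X"
  obtains "triple_above F X"
  | A B where "A \<in> F" "B \<in> F" "incomparable3 S A B" "X \<subseteq> S" "X \<subseteq> A" "X \<subseteq> B"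
proof -
  obtain A B C where ABC: "A \<in> insert S F" "B \<in> insert S F" "C \<in> insert S F"
    "incomparable3 A B C" "X \<subseteq> A" "X \<subseteq> B" "X \<subseteq> C"
    using assms by (rule triple_aboveE)
  consider "A = S" "B \<in> F" "C \<in> F" | "B = S" "A \<in> F" "C \<in> F" | "C = S" "A \<in> F" "B \<in> F"
    | "A \<in> F" "B \<in> F" "C \<in> F"
    using ABC by (auto simp: incomparable3_def)
  then show thesis
  proof cases
    case 1
    with ABC show thesis by (intro that(2)[of B C]) auto
  next
    case 2
    with ABC show thesis by (intro that(2)[of A C]) (auto simp: incomparable3_def)
  next
    case 3
    with ABC show thesis by (intro that(2)[of A B]) (auto simp: incomparable3_def)
  next
    case 4
    with ABC show thesis by (intro that(1)) (auto intro: triple_aboveI)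
  qed
qed

lemma embeds_insert:
  assumes "embeds P (insert S F) f"
  shows "embeds P F f \<or> S \<in> f ` Field P"
  using assms by (auto simp: embeds_def)

lemma inclusion_poset_iff: "(X, Y) \<in> inclusion_poset F \<longleftrightarrow> X \<in> F \<and> Y \<in> F \<and> X \<subseteq> Y"
  by (auto simp: inclusion_poset_def relation_of_def)

lemma contains_iff_embeds:
  "contains_induced_copy (inclusion_poset F) r \<longleftrightarrow> (\<exists>f. embeds r F f)"
  unfolding contains_induced_copy_def embeds_def Field_inclusion_poset
  by (intro iff_exI conj_cong ball_cong refl) (auto simp: inclusion_poset_iff)

lemma contains_V3_iff:
  "contains_induced_copy (inclusion_poset F) V3 \<longleftrightarrow> (\<exists>M\<in>F. triple_above F M)"
proof
  have Field_V3: "Field V3 = {0, 1, 2, 3}"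
    by (auto simp: V3_def Field_def)
  {
    assume "contains_induced_copy (inclusion_poset F) V3"
    then obtain f where f: "embeds V3 F f"
      unfolding contains_iff_embeds by (elim exE)
    then have all: "\<forall>u\<in>{0, 1, 2, 3}. \<forall>v\<in>{0, 1, 2, 3}. (u, v) \<in> V3 \<longleftrightarrow> f u \<subseteq> f v"
      unfolding embeds_def Field_V3 by (elim conjE)
    have iff: "(u, v) \<in> V3 \<longleftrightarrow> f u \<subseteq> f v" if "u \<in> {0, 1, 2, 3}" "v \<in> {0, 1, 2, 3}" for u v
      by (rule all[rule_format, OF that])
    have "\<not> f i \<subseteq> f j" if "i \<in> {1, 2, 3}" "j \<in> {1, 2, 3}" "i \<noteq> j" for i j
      using iff[of i j] that by (auto simp: V3_def)
    then have "incomparable3 (f 1) (f 2) (f 3)"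
      by (simp add: incomparable3_def)
    moreover have "f 0 \<subseteq> f 1" "f 0 \<subseteq> f 2" "f 0 \<subseteq> f 3"
      using iff[of 0 1] iff[of 0 2] iff[of 0 3] by (simp_all add: V3_def)
    moreover have "f 0 \<in> F" "f 1 \<in> F" "f 2 \<in> F" "f 3 \<in> F"
      using f by (auto simp: embeds_def Field_V3)
    ultimately show "\<exists>M\<in>F. triple_above F M"
      by (blast intro: triple_aboveI)
  next
    assume "\<exists>M\<in>F. triple_above F M"
    then obtain M where M: "M \<in> F" and "triple_above F M"
      by (elim bexE)
    from this(2) obtain A B C
      where ABC: "A \<in> F" "B \<in> F" "C \<in> F" "incomparable3 A B C" "M \<subseteq> A" "M \<subseteq> B" "M \<subseteq> C"
      by (rule triple_aboveE)
    let ?f = "\<lambda>k::nat. if k = 0 then M else if k = 1 then A else if k = 2 then B else C"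
    have ne: "\<not> A \<subseteq> M" "\<not> B \<subseteq> M" "\<not> C \<subseteq> M"
      using ABC by (auto simp: incomparable3_def)
    show "contains_induced_copy (inclusion_poset F) V3"
      unfolding contains_iff_embeds embeds_def Field_V3
    proof (intro exI[of _ ?f] conjI)
      show "inj_on ?f {0, 1, 2, 3}"
        using ABC ne by (auto simp: inj_on_def incomparable3_def)
      show "?f ` {0, 1, 2, 3} \<subseteq> F"
        using M ABC by auto
      show "\<forall>u\<in>{0, 1, 2, 3}. \<forall>v\<in>{0, 1, 2, 3}.
          (u, v) \<in> V3 \<longleftrightarrow> ?f u \<subseteq> ?f v"
        using ABC ne by (simp add: V3_def Id_on_iff incomparable3_def)
    qed
  }
qed

lemma antichain3_iff: "(i, j) \<in> antichain3 \<longleftrightarrow> i = j \<and> i \<in> {1, 2, 3}"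
  by (auto simp: antichain3_def)

text \<open>
  Reducing the lower part of the copy to the union of its members makes the copies of
  \<open>A\<^sub>3 * P\<close> look like those of \<open>V\<^sub>3\<close>, except that the bottom need not be a member of \<open>F\<close>.
\<close>

lemma contains_antichain3_sum_iff:
  "contains_induced_copy (inclusion_poset F) (linear_sum antichain3 P) \<longleftrightarrow>
     (\<exists>f. embeds P F f \<and> triple_above F (\<Union> (f ` Field P)))"
proof
  have Field_antichain3: "Field antichain3 = {1, 2, 3}"
    by (auto simp: antichain3_def Field_def)
  let ?r = "linear_sum antichain3 P"
  have Field_r: "Field ?r = Inl ` {1, 2, 3} \<union> Inr ` Field P"
    unfolding Field_linear_sum Field_antichain3 Plus_def by simp
  have r_iff: "(Inl x, Inl y) \<in> ?r \<longleftrightarrow> (x, y) \<in> antichain3" "(Inr u, Inr v) \<in> ?r \<longleftrightarrow> (u, v) \<in> P"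
    "(Inr u, Inl y) \<in> ?r \<longleftrightarrow> u \<in> Field P \<and> y \<in> {1, 2, 3}" "(Inl x, Inr v) \<notin> ?r" for x y u v
    by (auto simp: linear_sum_def Field_antichain3)
  {
    assume "contains_induced_copy (inclusion_poset F) ?r"
    then obtain h where "embeds ?r F h"
      unfolding contains_iff_embeds by (elim exE)
    then have h: "inj_on h (Field ?r)" "h ` Field ?r \<subseteq> F"
      and all: "\<forall>u\<in>Field ?r. \<forall>v\<in>Field ?r. (u, v) \<in> ?r \<longleftrightarrow> h u \<subseteq> h v"
      by (simp_all add: embeds_def)
    have iff: "(u, v) \<in> ?r \<longleftrightarrow> h u \<subseteq> h v" if "u \<in> Field ?r" "v \<in> Field ?r" for u v
      using all that by blast
    have "inj_on (\<lambda>u. h (Inr u)) (Field P)"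
      using h(1) by (simp add: inj_on_def Field_r)
    moreover have "(u, v) \<in> P \<longleftrightarrow> h (Inr u) \<subseteq> h (Inr v)" if "u \<in> Field P" "v \<in> Field P" for u v
      using iff[of "Inr u" "Inr v"] that by (simp add: Field_r r_iff(2))
    ultimately have "embeds P F (\<lambda>u. h (Inr u))"
      using h(2) by (simp add: embeds_def image_subset_iff Field_r)
    moreover have "\<not> h (Inl i) \<subseteq> h (Inl j)" if "i \<in> {1, 2, 3}" "j \<in> {1, 2, 3}" "i \<noteq> j" for i j
    proof -
      have "(Inl i, Inl j) \<notin> ?r"
        using that by (simp add: r_iff antichain3_iff)
      then show ?thesis
        using iff[of "Inl i" "Inl j"] that by (simp add: Field_r image_iff)
    qed
    then have "incomparable3 (h (Inl 1)) (h (Inl 2)) (h (Inl 3))"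
      by (simp add: incomparable3_def)
    moreover have "h (Inr u) \<subseteq> h (Inl k)" if "u \<in> Field P" "k \<in> {1, 2, 3}" for u k
      using iff[of "Inr u" "Inl k"] that by (simp add: Field_r r_iff(3) image_iff)
    moreover have "h (Inl k) \<in> F" if "k \<in> {1, 2, 3}" for k
      using h(2) that by (auto simp: Field_r)
    ultimately show "\<exists>f. embeds P F f \<and> triple_above F (\<Union> (f ` Field P))"
      by (intro exI[of _ "\<lambda>u. h (Inr u)"] conjI
          triple_aboveI[of "h (Inl 1)" F "h (Inl 2)" "h (Inl 3)"] UN_least) simp_all
  next
    assume "\<exists>f. embeds P F f \<and> triple_above F (\<Union> (f ` Field P))"
    then obtain f where f: "embeds P F f" and "triple_above F (\<Union> (f ` Field P))"
      by (elim exE conjE)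
    from this(2) obtain A B C where ABC: "A \<in> F" "B \<in> F" "C \<in> F" "incomparable3 A B C"
      and "\<Union> (f ` Field P) \<subseteq> A" "\<Union> (f ` Field P) \<subseteq> B" "\<Union> (f ` Field P) \<subseteq> C"
      by (rule triple_aboveE)
    then have le: "f u \<subseteq> A" "f u \<subseteq> B" "f u \<subseteq> C" if "u \<in> Field P" for u
      using that by (simp_all add: UN_subset_iff)
    let ?h = "case_sum (\<lambda>k::nat. if k = 1 then A else if k = 2 then B else C) f"
    have nle: "\<not> A \<subseteq> f u" "\<not> B \<subseteq> f u" "\<not> C \<subseteq> f u" if "u \<in> Field P" for u
      using le[OF that] ABC(4) by (auto simp: incomparable3_def)
    have fF: "f u \<in> F" if "u \<in> Field P" for u
      using f that by (auto simp: embeds_def)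
    show "contains_induced_copy (inclusion_poset F) ?r"
      unfolding contains_iff_embeds embeds_def Field_r
    proof (intro exI[of _ ?h] conjI)
      show "inj_on ?h (Inl ` {1, 2, 3} \<union> Inr ` Field P)"
        using ABC f nle by (auto simp: inj_on_def incomparable3_def embeds_def)
      show "?h ` (Inl ` {1, 2, 3} \<union> Inr ` Field P) \<subseteq> F"
        using ABC fF by auto
      show "\<forall>u\<in>Inl ` {1, 2, 3} \<union> Inr ` Field P. \<forall>v\<in>Inl ` {1, 2, 3} \<union> Inr ` Field P.
          (u, v) \<in> ?r \<longleftrightarrow> ?h u \<subseteq> ?h v"
        using ABC f nle le
        by (simp add: ball_Un incomparable3_def embeds_def r_iff antichain3_iff)
    qed
  }
qed

section \<open>Replacing the lower poset by a point\<close>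

lemma V3_saturated_iff:
  "poset_saturated n V3 F \<longleftrightarrow> F \<subseteq> Pow {1..n} \<and> (\<forall>M\<in>F. \<not> triple_above F M) \<and>
     (\<forall>S\<in>Pow {1..n} - F. \<exists>M\<in>insert S F. triple_above (insert S F) M)"
  by (simp add: poset_saturated_def poset_free_def contains_V3_iff)

text \<open>
  This carries the comparison of the saturation numbers. Only the removed sets could have served as
  the bottom of a copy of \<open>V\<^sub>3\<close>, and each of them is recovered as such when it is added again.
\<close>

lemma V3_saturated_of_antichain3_sum_saturated:
  assumes sat: "poset_saturated n (linear_sum antichain3 P) F"
  shows "poset_saturated n V3 {X \<in> F. \<not> triple_above F X}"
    (is "poset_saturated n V3 ?G")
proof -
  have F: "F \<subseteq> Pow {1..n}"
    and free: "\<And>f. embeds P F f \<Longrightarrow> \<not> triple_above F (\<Union> (f ` Field P))"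
    and add: "\<And>S. S \<subseteq> {1..n} \<Longrightarrow> S \<notin> F \<Longrightarrow>
      \<exists>f. embeds P (insert S F) f \<and> triple_above (insert S F) (\<Union> (f ` Field P))"
    using sat by (auto simp: poset_saturated_def poset_free_def contains_antichain3_sum_iff)
  have finF: "finite F"
    using F by (rule finite_subset) simp
  define U where "U = {\<Union> (f ` Field P) | f. embeds P F f}"
  have in_U: "\<Union> (f ` Field P) \<in> U" if "embeds P F f" for f
    using that unfolding U_def by blast
  have U: "U \<subseteq> Pow {1..n}"
    using F unfolding U_def by (force simp: embeds_def)
  have finU: "finite U"
    using U by (rule finite_subset) simp
  have union_not_below: "\<not> triple_above F M" if "M \<in> U" for M
    using that free unfolding U_def by blast
  \<comment> \<open>A set without a triple above it cannot enter the lower part of a copy, so it joins the triple.\<close>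
  have new: "\<exists>M\<in>U. \<exists>A\<in>F. \<exists>B\<in>F. incomparable3 S A B \<and> M \<subseteq> S \<and> M \<subseteq> A \<and> M \<subseteq> B"
    if S: "S \<subseteq> {1..n}" "S \<notin> F" "\<not> triple_above F S" for S
  proof -
    obtain f where f: "embeds P (insert S F) f" "triple_above (insert S F) (\<Union> (f ` Field P))"
      using add[OF S(1,2)] by blast
    have "S \<notin> f ` Field P"
    proof
      assume "S \<in> f ` Field P"
      then have le: "S \<subseteq> \<Union> (f ` Field P)"
        by blast
      from f(2) show False
      proof (cases rule: triple_above_insert)
        case 1
        then show False
          using S(3) triple_above_antimono le by blast
      next
        case (2 A B)
        then show False
          using le by (auto simp: incomparable3_def)
      qed
    qed
    with f(1) have fF: "embeds P F f"
      using embeds_insert by blast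
    from f(2) show ?thesis
    proof (cases rule: triple_above_insert)
      case 1
      with free fF show ?thesis by blast
    next
      case (2 A B)
      with in_U[OF fF] show ?thesis by blast
    qed
  qed
  have "\<exists>M\<in>insert S ?G. triple_above (insert S ?G) M" if S: "S \<subseteq> {1..n}" "S \<notin> ?G" for S
  proof (cases "triple_above F S")
    case True
    \<comment> \<open>Above a maximal such set, all members of a triple survive in \<open>?G\<close>.\<close>
    let ?B = "{X \<in> insert S F. triple_above F X}"
    have "finite ?B" "S \<in> ?B"
      using finF True by auto
    then obtain X where X: "X \<in> ?B" "S \<subseteq> X" and X_max: "\<forall>Y\<in>?B. X \<subseteq> Y \<longrightarrow> X = Y"
      using finite_has_maximal2[of ?B S] by metis
    then have "triple_above F X"
      by blast
    then obtain A B C where ABC: "A \<in> F" "B \<in> F" "C \<in> F" "incomparable3 A B C"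
      "X \<subseteq> A" "X \<subseteq> B" "X \<subseteq> C"
      by (rule triple_aboveE)
    moreover have "A \<noteq> X" "B \<noteq> X" "C \<noteq> X"
      using ABC by (auto simp: incomparable3_def)
    ultimately have "A \<in> ?G" "B \<in> ?G" "C \<in> ?G"
      using X_max by auto
    then have "triple_above (insert S ?G) S"
      using ABC X(2) by (intro triple_aboveI[of A _ B C]) auto
    then show ?thesis by blast
  next
    case False
    then obtain M0 A B where M0: "M0 \<in> U"
      and AB: "A \<in> F" "B \<in> F" "incomparable3 S A B" "M0 \<subseteq> S" "M0 \<subseteq> A" "M0 \<subseteq> B"
      using new[of S] S by auto
    obtain M where M: "M \<in> U" "M \<subseteq> M0" and M_min: "\<forall>Y\<in>U. Y \<subseteq> M \<longrightarrow> M = Y"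
      using finite_has_minimal2[OF finU M0] by (elim bexE conjE) rule
    \<comment> \<open>Otherwise \<open>M\<close> itself would join a triple, above a union properly contained in \<open>M\<close>.\<close>
    have "M \<in> F"
    proof (rule ccontr)
      assume "M \<notin> F"
      moreover have "M \<subseteq> {1..n}"
        using U M(1) by blast
      ultimately obtain M' A' B' where M': "M' \<in> U" and "A' \<in> F" "B' \<in> F"
        and *: "incomparable3 M A' B'" "M' \<subseteq> M" "M' \<subseteq> A'" "M' \<subseteq> B'"
        using new[of M] union_not_below[OF M(1)] by blast
      then have "M' = M"
        using M_min by blast
      with * show False
        by (auto simp: incomparable3_def)
    qed
    then have "M \<in> ?G"
      using union_not_below M(1) by blast
    moreover have "\<not> triple_above F A" "\<not> triple_above F B"
      using union_not_below[OF M0] triple_above_antimono[of F _ M0] AB(5,6) by blast+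
    then have "A \<in> ?G" "B \<in> ?G"
      using AB(1,2) by simp_all
    ultimately have "triple_above (insert S ?G) M"
      using AB M(2) by (intro triple_aboveI[of S _ A B]) auto
    then show ?thesis
      using \<open>M \<in> ?G\<close> by blast
  qed
  moreover have "\<not> triple_above ?G M" if "M \<in> ?G" for M
  proof -
    have "\<not> triple_above F M" "?G \<subseteq> F"
      using that by auto
    then show ?thesis
      using triple_above_mono by blast
  qed
  moreover have "?G \<subseteq> Pow {1..n}"
    using F by blast
  ultimately show ?thesis
    unfolding V3_saturated_iff by simp
qed

lemma sat_star_le:
  assumes "poset_saturated n r F"
  shows "sat_star n r \<le> card F"
  unfolding sat_star_def using assms finite_poset_saturated by (intro Min_le) auto

lemma sat_star_attained:
  assumes "r \<noteq> {}"
  obtains F where "poset_saturated n r F" "card F = sat_star n r"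
proof -
  have "sat_star n r \<in> card ` {F. poset_saturated n r F}"
    unfolding sat_star_def
    using finite_poset_saturated poset_saturated_exists[OF assms] by (intro Min_in) auto
  then show thesis
    using that by auto
qed

lemma sat_star_V3_le_antichain3_sum:
  "sat_star n V3 \<le> sat_star n (linear_sum antichain3 P)"
proof -
  have "(Inl 1, Inl 1) \<in> linear_sum antichain3 P"
    by (auto simp: linear_sum_def antichain3_def)
  then obtain F where F: "poset_saturated n (linear_sum antichain3 P) F"
    "card F = sat_star n (linear_sum antichain3 P)"
    using sat_star_attained by (metis empty_iff)
  have "finite F"
    using F(1) unfolding poset_saturated_def by (meson finite_Pow_iff finite_atLeastAtMost finite_subset)
  then have "card {X \<in> F. \<not> triple_above F X} \<le> card F"
    by (intro card_mono) auto
  with sat_star_le[OF V3_saturated_of_antichain3_sum_saturated[OF F(1)]] F(2) show ?thesis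
    by linarith
qed

section \<open>The linear lower bound\<close>

lemma card_le_mult_of_fibres:
  assumes "finite B" "g ` A \<subseteq> B" "finite A"
    and fibre: "\<And>i j k. \<lbrakk>i \<in> A; j \<in> A; k \<in> A; i \<noteq> j; i \<noteq> k; j \<noteq> k; g i = g j; g i = g k\<rbrakk> \<Longrightarrow> False"
  shows "card A \<le> 2 * card B"
proof -
  have "card {i \<in> A. g i = y} \<le> 2" for y
  proof (rule ccontr)
    assume "\<not> ?thesis"
    then obtain T where "T \<subseteq> {i \<in> A. g i = y}" "card T = 3"
      using obtain_subset_with_card_n[of 3 "{i \<in> A. g i = y}"] by auto
    then obtain i j k where "i \<noteq> j" "i \<noteq> k" "j \<noteq> k" "{i, j, k} \<subseteq> {i \<in> A. g i = y}"
      unfolding card_3_iff by metis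
    then show False
      using fibre[of i j k] by simp
  qed
  then have "(\<Sum>y\<in>B. card {i \<in> A. g i = y}) \<le> (\<Sum>y\<in>B. 2)"
    by (intro sum_mono)
  moreover have "(\<Sum>y\<in>B. card {i \<in> A. g i = y}) = card A"
    using sum.group[OF assms(3,1,2), of "\<lambda>_. 1::nat"] by simp
  ultimately show ?thesis
    by simp
qed

text \<open>
  The two kinds of assigned members are provided by \<open>ex_missing\<close> and \<open>ex_added\<close>. Maximality in
  \<open>missing\<close> is what keeps the two kinds apart: a member assigned to some \<open>i \<notin> M\<close> either contains
  \<open>M\<close> or can be enlarged without changing what it misses from \<open>M\<close>.
\<close>

lemma V3_saturated_card_ge:
  assumes sat: "poset_saturated n V3 F"
  shows "n \<le> 2 * card F"
proof -
  have F: "F \<subseteq> Pow {1..n}" and free: "\<And>M. M \<in> F \<Longrightarrow> \<not> triple_above F M"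
    and add: "\<And>S. S \<subseteq> {1..n} \<Longrightarrow> S \<notin> F \<Longrightarrow> \<exists>M\<in>insert S F. triple_above (insert S F) M"
    using sat by (auto simp: V3_saturated_iff)
  have finF: "finite F"
    using F by (rule finite_subset) simp
  have new: "\<exists>N\<in>F. \<exists>A\<in>F. \<exists>B\<in>F. incomparable3 S A B \<and> N \<subseteq> S \<and> N \<subseteq> A \<and> N \<subseteq> B"
    if S: "S \<subseteq> {1..n}" "S \<notin> F" "\<not> triple_above F S" for S
  proof -
    obtain N where N: "N \<in> insert S F" "triple_above (insert S F) N"
      using add S by blast
    from N(2) show ?thesis
    proof (cases rule: triple_above_insert)
      case 1
      then show ?thesis using N(1) free S(3) by blast
    next
      case (2 A B)
      then have "N \<noteq> S"
        by (auto simp: incomparable3_def)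
      with N(1) 2 show ?thesis by blast
    qed
  qed
  have "F \<noteq> {}"
    using add[of "{}"] by (auto simp: triple_above_def incomparable3_def)
  then obtain M where M: "M \<in> F" and M_min: "\<forall>Y\<in>F. Y \<subseteq> M \<longrightarrow> M = Y"
    using finite_has_minimal[OF finF] by blast

  define missing where
    "missing j C \<longleftrightarrow> C \<in> F \<and> C \<inter> M = M - {j} \<and> (\<forall>D\<in>F. D \<inter> M = M - {j} \<longrightarrow> C \<subseteq> D \<longrightarrow> C = D)"
    for j C
  have ex_missing: "\<exists>C. missing j C" if j: "j \<in> M" for j
  proof -
    \<comment> \<open>Minimality of \<open>M\<close> leaves nothing that could be the bottom of a copy below \<open>M - {j}\<close>, so a
      triple lies above \<open>M - {j}\<close>; not all of it lies above \<open>M\<close>.\<close>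
    have "M - {j} \<notin> F"
      using M_min j by blast
    moreover have "\<not> N \<subseteq> M - {j}" if "N \<in> F" for N
      using M_min j that by blast
    ultimately have "triple_above F (M - {j})"
      using new[of "M - {j}"] M F by blast
    then obtain A B C where ABC: "A \<in> F" "B \<in> F" "C \<in> F" "incomparable3 A B C"
      "M - {j} \<subseteq> A" "M - {j} \<subseteq> B" "M - {j} \<subseteq> C"
      by (rule triple_aboveE)
    have "\<not> (M \<subseteq> A \<and> M \<subseteq> B \<and> M \<subseteq> C)"
      using ABC(1-4) free[OF M] triple_aboveI[of A F B C M] by blast
    then obtain D where "D \<in> F" "\<not> M \<subseteq> D" "M - {j} \<subseteq> D"
      using ABC by blast
    then have "D \<in> F" "D \<inter> M = M - {j}"
      by blast+
    then have D: "D \<in> {D \<in> F. D \<inter> M = M - {j}}"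
      by blast
    have fin: "finite {D \<in> F. D \<inter> M = M - {j}}"
      using finF by simp
    show ?thesis
      using finite_has_maximal2[OF fin D] unfolding missing_def by auto
  qed

  have ex_added: "\<exists>L X. L \<in> F \<and> X \<in> F \<and> M \<subseteq> X \<and> i \<notin> X \<and> i \<in> L \<and> L \<subseteq> insert i X \<and>
      (\<forall>j\<in>M. \<not> missing j L)" if i: "i \<in> {1..n} - M" for i
  proof -
    have "finite {X \<in> F. M \<subseteq> X \<and> i \<notin> X}" "M \<in> {X \<in> F. M \<subseteq> X \<and> i \<notin> X}"
      using finF M i by auto
    from finite_has_maximal2[OF this]
    obtain X where X: "X \<in> F" "M \<subseteq> X" "i \<notin> X"
      and "\<forall>Y\<in>{X \<in> F. M \<subseteq> X \<and> i \<notin> X}. X \<subseteq> Y \<longrightarrow> X = Y"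
      by auto
    then have X_max: "X = Y" if "Y \<in> F" "X \<subseteq> Y" "i \<notin> Y" for Y
      using that by auto
    show ?thesis
    proof (cases "insert i X \<in> F")
      case True
      have "\<not> missing j (insert i X)" if "j \<in> M" for j
        using that X by (auto simp: missing_def)
      with True X show ?thesis by blast
    next
      case False
      moreover have "\<not> triple_above F (insert i X)"
        using free[OF X(1)] triple_above_antimono by blast
      ultimately obtain N A B where NAB: "N \<in> F" "A \<in> F" "B \<in> F"
        "incomparable3 (insert i X) A B" "N \<subseteq> insert i X" "N \<subseteq> A" "N \<subseteq> B"
        using new[of "insert i X"] X F i by blast
      have nsub: "\<not> X \<subseteq> Y" if "Y \<in> F" "\<not> Y \<subseteq> insert i X" "\<not> insert i X \<subseteq> Y" for Y
        using X_max that by blast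
      have inc: "incomparable3 X A B"
        using NAB nsub[of A] nsub[of B] unfolding incomparable3_def by blast
      \<comment> \<open>By maximality of \<open>X\<close>, the triple of \<open>insert i X\<close>, \<open>A\<close>, \<open>B\<close> stays incomparable when \<open>i\<close> is
        dropped, so \<open>X\<close>, \<open>A\<close>, \<open>B\<close> have no common lower bound in \<open>F\<close>.\<close>
      have iN: "i \<in> N"
      proof (rule ccontr)
        assume "i \<notin> N"
        then have "triple_above F N"
          using NAB X inc by (intro triple_aboveI[of X F A B]) auto
        with free NAB(1) show False by blast
      qed
      have "\<not> missing j N" if j: "j \<in> M" for j
      proof
        assume N: "missing j N"
        \<comment> \<open>As \<open>N\<close> is maximal with its trace on \<open>M\<close>, both \<open>A\<close> and \<open>B\<close> contain \<open>j\<close> and thus \<open>M\<close>.\<close>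
        have "j \<in> Y" if "Y \<in> F" "N \<subseteq> Y" "\<not> Y \<subseteq> N" for Y
        proof (rule ccontr)
          assume "j \<notin> Y"
          then have "Y \<inter> M = M - {j}"
            using N that by (auto simp: missing_def)
          then show False
            using N that unfolding missing_def by blast
        qed
        moreover have "\<not> A \<subseteq> N" "\<not> B \<subseteq> N"
          using NAB(4,5) by (auto simp: incomparable3_def)
        ultimately have "j \<in> A" "j \<in> B"
          using NAB(2,3,6,7) by simp_all
        moreover have "M - {j} \<subseteq> A" "M - {j} \<subseteq> B"
          using N NAB(6,7) by (auto simp: missing_def)
        ultimately have "M \<subseteq> A" "M \<subseteq> B"
          by blast+
        then have "triple_above F M"
          using NAB X inc by (intro triple_aboveI[of X F A B]) auto
        with free M show False by blast
      qed
      with NAB X iN show ?thesis by blast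
    qed
  qed

  have "\<forall>j\<in>M. \<exists>C. missing j C"
    using ex_missing by simp
  from bchoice[OF this] obtain C where C: "missing j (C j)" if "j \<in> M" for j
    by blast
  obtain L X where LX: "\<And>i. i \<in> {1..n} - M \<Longrightarrow> L i \<in> F \<and> X i \<in> F \<and> M \<subseteq> X i \<and> i \<notin> X i \<and> i \<in> L i
      \<and> L i \<subseteq> insert i (X i) \<and> (\<forall>j\<in>M. \<not> missing j (L i))"
    using ex_added by metis
  let ?g = "\<lambda>i. if i \<in> M then C i else L i"
  have C_inj: "i = j" if "i \<in> M" "j \<in> M" "C i = C j" for i j
    using C[of i] C[of j] that by (auto simp: missing_def)
  have "card {1..n} \<le> 2 * card F"
  proof (rule card_le_mult_of_fibres)
    show "?g ` {1..n} \<subseteq> F"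
      using C LX by (auto simp: missing_def)
    fix i j k
    assume ijk: "i \<in> {1..n}" "j \<in> {1..n}" "k \<in> {1..n}" "i \<noteq> j" "i \<noteq> k" "j \<noteq> k"
      and g: "?g i = ?g j" "?g i = ?g k"
    have out: "p \<in> {1..n} - M" if "p \<in> {1..n}" "q \<in> {1..n}" "p \<noteq> q" "?g p = ?g q" for p q
    proof -
      have "p \<notin> M"
      proof
        assume p: "p \<in> M"
        show False
        proof (cases "q \<in> M")
          case True
          then show False using C_inj[of p q] p that by simp
        next
          case False
          then have "missing p (L q)"
            using C[OF p] p that(4) by simp
          then show False
            using LX[of q] p False that(2) by simp
        qed
      qed
      then show ?thesis using that(1) by simp
    qed
    have i: "i \<in> {1..n} - M" and j: "j \<in> {1..n} - M" and k: "k \<in> {1..n} - M"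
      using out[of i j] out[of j i] out[of k i] ijk g by simp_all
    have eq: "L i = L j" "L i = L k"
      using g i j k by simp_all
    have nle: "\<not> X q \<subseteq> X p"
      if "p \<in> {1..n} - M" "q \<in> {1..n} - M" "p \<noteq> q" "L p = L q" for p q
    proof -
      have "p \<in> X q"
        using LX[OF that(1)] LX[OF that(2)] that(3,4) by auto
      then show ?thesis
        using LX[OF that(1)] by blast
    qed
    have "incomparable3 (X i) (X j) (X k)"
      using nle i j k ijk eq by (simp add: incomparable3_def)
    then have "triple_above F M"
      using LX[OF i] LX[OF j] LX[OF k] by (intro triple_aboveI[of "X i" F "X j" "X k"]) simp_all
    with free M show False by blast
  qed (use finF in auto)
  then show ?thesis by simp
qed

lemma sat_star_V3_ge: "real n / 2 \<le> real (sat_star n V3)"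
proof -
  have "(0, 0) \<in> V3"
    by (simp add: V3_def Id_on_iff)
  then obtain F where "poset_saturated n V3 F" "card F = sat_star n V3"
    using sat_star_attained by (metis empty_iff)
  then show ?thesis
    using V3_saturated_card_ge[of n F] by linarith
qed

section \<open>Duality\<close>

lemma contains_induced_copy_trans:
  assumes "contains_induced_copy t s" "contains_induced_copy s r"
  shows "contains_induced_copy t r"
proof -
  obtain f where f: "inj_on f (Field s)" "f ` Field s \<subseteq> Field t"
    "\<forall>u\<in>Field s. \<forall>v\<in>Field s. (u, v) \<in> s \<longleftrightarrow> (f u, f v) \<in> t"
    using assms(1) unfolding contains_induced_copy_def by (elim exE conjE) rule
  obtain g where g: "inj_on g (Field r)" "g ` Field r \<subseteq> Field s"
    "\<forall>u\<in>Field r. \<forall>v\<in>Field r. (u, v) \<in> r \<longleftrightarrow> (g u, g v) \<in> s"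
    using assms(2) unfolding contains_induced_copy_def by (elim exE conjE) rule
  show ?thesis
    unfolding contains_induced_copy_def
  proof (intro exI[of _ "f \<circ> g"] conjI ballI)
    show "inj_on (f \<circ> g) (Field r)"
      using f(1) g(1,2) by (meson comp_inj_on inj_on_subset)
    show "(f \<circ> g) ` Field r \<subseteq> Field t"
      using f(2) g(2) by auto
    show "(u, v) \<in> r \<longleftrightarrow> ((f \<circ> g) u, (f \<circ> g) v) \<in> t" if "u \<in> Field r" "v \<in> Field r" for u v
      using that f(3) g(2,3) by (simp add: image_subset_iff)
  qed
qed

lemma contains_induced_copy_converse:
  "contains_induced_copy (s\<inverse>) (r\<inverse>) \<longleftrightarrow> contains_induced_copy s r"
  unfolding contains_induced_copy_def Field_converse
  by (intro iff_exI conj_cong refl) auto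

lemma complement_twice: "X \<subseteq> T \<Longrightarrow> T - (T - X) = X"
  by blast

lemma inj_on_complement: "F \<subseteq> Pow T \<Longrightarrow> inj_on ((-) T) F"
  by (rule inj_on_inverseI[of _ "(-) T"]) (auto simp: complement_twice)

lemma image_complement_twice:
  assumes "F \<subseteq> Pow T"
  shows "(-) T ` (-) T ` F = F"
proof -
  have "(\<lambda>X. T - (T - X)) ` F = (\<lambda>X. X) ` F"
    using assms by (intro image_cong refl complement_twice) auto
  then show ?thesis
    by (simp add: image_image)
qed

lemma contains_complement:
  assumes F: "F \<subseteq> Pow T"
  shows "contains_induced_copy ((inclusion_poset ((-) T ` F))\<inverse>) (inclusion_poset F)"
  unfolding contains_induced_copy_def Field_converse Field_inclusion_poset
proof (intro exI[of _ "(-) T"] conjI ballI)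
  fix u v assume "u \<in> F" "v \<in> F"
  moreover from this have "u \<subseteq> v \<longleftrightarrow> T - v \<subseteq> T - u"
    using F by blast
  ultimately show "(u, v) \<in> inclusion_poset F \<longleftrightarrow>
      (T - u, T - v) \<in> (inclusion_poset ((-) T ` F))\<inverse>"
    by (simp add: inclusion_poset_iff)
qed (use F inj_on_complement in auto)

lemma contains_dual:
  assumes F: "F \<subseteq> Pow T"
    and dual: "contains_induced_copy (r\<inverse>) r'" "contains_induced_copy r' (r\<inverse>)"
  shows "contains_induced_copy (inclusion_poset ((-) T ` F)) r' \<longleftrightarrow>
    contains_induced_copy (inclusion_poset F) r"
proof -
  let ?F' = "(-) T ` F"
  have a: "contains_induced_copy ((inclusion_poset F)\<inverse>) (inclusion_poset ?F')"
    using contains_complement[of ?F' T] image_complement_twice[OF F] by auto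
  have b: "contains_induced_copy (inclusion_poset ?F') ((inclusion_poset F)\<inverse>)"
    using contains_complement[OF F] contains_induced_copy_converse by force
  have "contains_induced_copy (inclusion_poset ?F') r' \<longleftrightarrow>
      contains_induced_copy ((inclusion_poset F)\<inverse>) (r\<inverse>)"
  proof
    assume "contains_induced_copy (inclusion_poset ?F') r'"
    from contains_induced_copy_trans[OF a contains_induced_copy_trans[OF this dual(2)]]
    show "contains_induced_copy ((inclusion_poset F)\<inverse>) (r\<inverse>)" .
  next
    assume "contains_induced_copy ((inclusion_poset F)\<inverse>) (r\<inverse>)"
    from contains_induced_copy_trans[OF b contains_induced_copy_trans[OF this dual(1)]]
    show "contains_induced_copy (inclusion_poset ?F') r'" .
  qed
  then show ?thesis
    by (simp add: contains_induced_copy_converse)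
qed

text \<open>
  Saturation depends only on which families contain a copy, so the converse of \<open>r\<close> may be replaced
  by any \<open>r'\<close> such that the two contain copies of each other. This covers linear sums, whose two summands change
  sides, and hence types, under duality.
\<close>

lemma poset_saturated_dual:
  assumes dual: "contains_induced_copy (r\<inverse>) r'" "contains_induced_copy r' (r\<inverse>)"
    and sat: "poset_saturated n r F"
  shows "poset_saturated n r' ((-) {1..n} ` F)"
proof -
  let ?T = "{1..n}"
  have F: "F \<subseteq> Pow ?T"
    using sat by (simp add: poset_saturated_def)
  have "contains_induced_copy (inclusion_poset ((-) ?T ` F \<union> {S})) r'"
    if S: "S \<in> Pow ?T - (-) ?T ` F" for S
  proof -
    have "?T - (?T - S) = S"
      using S by blast
    then have "?T - S \<in> Pow ?T - F" and eq: "(-) ?T ` (F \<union> {?T - S}) = (-) ?T ` F \<union> {S}"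
      using S by auto
    then have "contains_induced_copy (inclusion_poset (F \<union> {?T - S})) r"
      using sat by (simp add: poset_saturated_def)
    then show ?thesis
      using contains_dual[OF _ dual, of "F \<union> {?T - S}" ?T] F unfolding eq by auto
  qed
  then show ?thesis
    using sat contains_dual[OF F dual] by (auto simp: poset_saturated_def poset_free_def)
qed

lemma card_complement: "F \<subseteq> Pow T \<Longrightarrow> card ((-) T ` F) = card F"
  by (intro card_image inj_on_complement)

lemma sat_star_dual:
  assumes dual: "contains_induced_copy (r\<inverse>) r'" "contains_induced_copy r' (r\<inverse>)"
  shows "sat_star n r' = sat_star n r"
proof -
  have dual': "contains_induced_copy (r'\<inverse>) r" "contains_induced_copy r (r'\<inverse>)"
    using dual contains_induced_copy_converse[of "r'" "r\<inverse>"]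
      contains_induced_copy_converse[of "r\<inverse>" "r'"] by simp_all
  have sub: "card ` {F. poset_saturated n q F} \<subseteq> card ` {F. poset_saturated n q' F}"
    if "contains_induced_copy (q\<inverse>) q'" "contains_induced_copy q' (q\<inverse>)"
    for q :: "'c rel" and q' :: "'d rel"
  proof
    fix c assume "c \<in> card ` {F. poset_saturated n q F}"
    then obtain F where F: "poset_saturated n q F" "c = card F"
      by blast
    then have "c = card ((-) {1..n} ` F)"
      by (simp add: card_complement poset_saturated_def)
    with poset_saturated_dual[OF that F(1)] show "c \<in> card ` {F. poset_saturated n q' F}"
      by blast
  qed
  show ?thesis
    unfolding sat_star_def subset_antisym[OF sub[OF dual] sub[OF dual']] by (rule refl)
qed

lemma sat_star_Lambda3: "sat_star n Lambda3 = sat_star n V3"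
proof (rule sat_star_dual)
  have "V3\<inverse> = Lambda3"
    by (auto simp: V3_def Lambda3_def)
  then show "contains_induced_copy (V3\<inverse>) Lambda3" "contains_induced_copy Lambda3 (V3\<inverse>)"
    unfolding contains_induced_copy_def by (auto intro!: exI[of _ id])
qed

lemma contains_converse_linear_sum:
  "contains_induced_copy ((linear_sum p q)\<inverse>) (linear_sum (q\<inverse>) (p\<inverse>))"
  unfolding contains_induced_copy_def Field_converse Field_linear_sum
proof (intro exI[of _ "case_sum Inr Inl"] conjI ballI)
  show "inj_on (case_sum Inr Inl) (Field q <+> Field p)"
    by (auto simp: inj_on_def)
  show "case_sum Inr Inl ` (Field q <+> Field p) \<subseteq> Field p <+> Field q"
    by auto
  show "(u, v) \<in> linear_sum (q\<inverse>) (p\<inverse>) \<longleftrightarrow>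
      (case_sum Inr Inl u, case_sum Inr Inl v) \<in> (linear_sum p q)\<inverse>" for u v
    by (cases u; cases v) (auto simp: linear_sum_def)
qed

lemma sat_star_linear_sum_converse:
  "sat_star n (linear_sum (q\<inverse>) (p\<inverse>)) = sat_star n (linear_sum p q)"
proof (rule sat_star_dual)
  show "contains_induced_copy (linear_sum (q\<inverse>) (p\<inverse>)) ((linear_sum p q)\<inverse>)"
    using contains_converse_linear_sum[of "q\<inverse>" "p\<inverse>"]
      contains_induced_copy_converse[of "linear_sum (q\<inverse>) (p\<inverse>)" "(linear_sum p q)\<inverse>"] by simp
qed (rule contains_converse_linear_sum)

theorem corollary4:
  fixes n :: nat and P :: "'a rel"
  assumes "n > 0"
    and "Partial_order P"
    and "finite (Field P)"
    and "Field P \<noteq> {}"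
  shows "(\<not> (\<exists>!x. maximal_element P x) \<longrightarrow>
            sat_star n (linear_sum antichain3 P) \<ge> sat_star n V3 \<and>
            real (sat_star n V3) \<ge> real n / 2) \<and>
         (\<not> (\<exists>!x. minimal_element P x) \<longrightarrow>
            sat_star n (linear_sum P antichain3) \<ge> sat_star n Lambda3 \<and>
            real (sat_star n Lambda3) \<ge> real n / 2)"
proof -
  have "antichain3\<inverse> = antichain3"
    by (auto simp: antichain3_def)
  then have "sat_star n (linear_sum P antichain3) = sat_star n (linear_sum antichain3 (P\<inverse>))"
    using sat_star_linear_sum_converse[of n antichain3 P] by simp
  then show ?thesis
    using sat_star_V3_le_antichain3_sum[of n P] sat_star_V3_le_antichain3_sum[of n "P\<inverse>"]
      sat_star_V3_ge[of n] by (simp add: sat_star_Lambda3)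
qed

end
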